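(* Let $N,K,N_{cp},V$ be integers with $K\ge 2$ even, $K\le N$, $N_{cp}\ge 0$, $V\ge 0$ and $V+1\le K$, and let $\mathbf X_0,\mathbf X_1,\mathbf X_2,\dots\in\mathbb C^K$ be arbitrary data vectors. Let $(\overline{\mathbf X}_i)_{i\ge 0}$ be the sequence of NC-OFDM precoded vectors, and let $(w_i)_{i\ge1}$ and $(\overline y_i)_{i\ge0}$ be the smooth signals and smoothed symbols of TD-NC-OFDM, generated from the same data, as defined in the context. Then NC-OFDM and TD-NC-OFDM are equivalent: for every $i\ge 1$, the frequency-domain expression $\mathbf W_i=\mathbf F_f\mathbf w_i$ of the smooth signal, where $\mathbf w_i=[w_i(0),\dots,w_i(N-1)]^T$, satisfies $$\mathbf W_i=-\mathbf P\mathbf X_i+\mathbf P\mathbf\Phi^H\overline{\mathbf X}_{i-1},$$ and consequently, for every $i\ge 0$ and every $n\in\{-N_{cp},\dots,N-1\}$, $$\overline y_i(n)=\frac1N\sum_{m=0}^{K-1}\overline X_{i,k_m}\,e^{j2\pi k_m n/N},$$ where $\overline X_{i,k_m}$ denotes the entry of $\overline{\mathbf X}_i$ associated with subcarrier $k_m$.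
   Context: Notation: $j$ is the imaginary unit, $0^0=1$, and $(\cdot)^H$ is the conjugate transpose. The subcarrier indices are $k_m=-K/2+m$ for $m=0,\dots,K-1$, and $\mathcal K_0=\{-K/2,\dots,K/2-1\}$. A data vector is written $\mathbf X_i=[X_{i,k_0},\dots,X_{i,k_{K-1}}]^T$. Put $\varphi=-2\pi N_{cp}/N$ and $\mathbf\Phi=\mathrm{diag}(e^{j\varphi k_0},\dots,e^{j\varphi k_{K-1}})$. $\mathbf F_f$ is the $K\times N$ matrix with entry $e^{-j2\pi k_m n/N}$ in the row indexed by $m\in\{0,\dots,K-1\}$ and the column indexed by $n\in\{0,\dots,N-1\}$. NC-OFDM (frequency-domain precoding). $\mathbf A$ is the $(V+1)\times K$ matrix with $\{\mathbf A\}_{v+1,m+1}=k_m^v$ ($0\le v\le V$, $0\le m\le K-1$), and $\mathbf P=\mathbf\Phi^H\mathbf A^H(\mathbf A\mathbf A^H)^{-1}\mathbf A\mathbf\Phi$. The precoded vectors are $\overline{\mathbf X}_0=\mathbf X_0$ and, for $i>0$, $\overline{\mathbf X}_i=(\mathbf I_K-\mathbf P)\mathbf X_i+\mathbf P\mathbf\Phi^H\overline{\mathbf X}_{i-1}$. TD-NC-OFDM (time-domain smoothing). All signals below are trigonometric polynomials in $n$ regarded as a real variable, and $(\cdot)^{(v)}$ denotes the $v$-th derivative with respect to $n$. The original OFDM symbol is $y_i(n)=\frac1N\sum_{m=0}^{K-1}X_{i,k_m}e^{j2\pi k_m n/N}$. The basis function is $f(n)=\frac1N\sum_{m=0}^{K-1}e^{-j\varphi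 k_m}e^{j2\pi k_m n/N}$, so that $f^{(v)}(n)=\frac1N\sum_{m=0}^{K-1}\left(\frac{j2\pi k_m}{N}\right)^v e^{-j\varphi k_m}e^{j2\pi k_m n/N}$. $\mathbf P_f$ is the $(V+1)\times(V+1)$ matrix with entries $\{\mathbf P_f\}_{u+1,v+1}=f^{(u+v)}(-N_{cp})$, $0\le u,v\le V$ (it is invertible under the stated assumptions). The smoothed symbols are $\overline y_0=y_0$ and, for $i>0$, $\overline y_i(n)=y_i(n)+w_i(n)$ with smooth signal $w_i(n)=\sum_{v=0}^{V}b_{i,v}f^{(v)}(n)$, where $\mathbf b_i=[b_{i,0},\dots,b_{i,V}]^T=\mathbf P_f^{-1}\Delta\mathbf y_i$ and $\Delta\mathbf y_i$ is the vector in $\mathbb C^{V+1}$ whose $(v+1)$-th entry is $\overline y_{i-1}^{(v)}(N)-y_i^{(v)}(-N_{cp})$, $0\le v\le V$. *)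

theory Defs
  imports
    "HOL-Analysis.Analysis"
    "Jordan_Normal_Form.Gauss_Jordan_Elimination"
    "Jordan_Normal_Form.Schur_Decomposition"
begin

unbundle no vec_syntax

text \<open>
  Parameters: \<open>N\<close> DFT size, \<open>K\<close> number of subcarriers (even), \<open>C\<close> cyclic prefix length
  \<open>N\<^sub>c\<^sub>p\<close>, \<open>V\<close> highest derivative order.  Vectors and matrices are those of
  \<open>Jordan_Normal_Form\<close>, indexed from 0, so the entry at subcarrier \<open>k\<^sub>m\<close> has index \<open>m\<close>.
  Note that \<open>cis t = exp (\<i> * t)\<close>.
\<close>

definition subcarrier :: "nat \<Rightarrow> nat \<Rightarrow> int" where
  "subcarrier K m = - (int K div 2) + int m"

definition phi :: "nat \<Rightarrow> nat \<Rightarrow> real" where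
  "phi N C = - 2 * pi * real C / real N"

definition Phi_mat :: "nat \<Rightarrow> nat \<Rightarrow> nat \<Rightarrow> complex mat" where
  "Phi_mat N K C = mat_diag K (\<lambda>m. cis (phi N C * of_int (subcarrier K m)))"

definition F_mat :: "nat \<Rightarrow> nat \<Rightarrow> complex mat" where
  "F_mat N K = Matrix.mat K N (\<lambda>(m, n). cis (- 2 * pi * of_int (subcarrier K m) * real n / real N))"

text \<open>\<open>mat_inverse\<close> is option-valued; the value is unspecified for a singular matrix.\<close>

definition minv :: "complex mat \<Rightarrow> complex mat" where
  "minv M = the (mat_inverse M)"

subsection \<open>NC-OFDM\<close>

definition A_mat :: "nat \<Rightarrow> nat \<Rightarrow> complex mat" where
  "A_mat K V = Matrix.mat (V + 1) K (\<lambda>(v, m). of_int (subcarrier K m) ^ v)"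

definition P_mat :: "nat \<Rightarrow> nat \<Rightarrow> nat \<Rightarrow> nat \<Rightarrow> complex mat" where
  "P_mat N K C V =
     mat_adjoint (Phi_mat N K C) * mat_adjoint (A_mat K V) *
     minv (A_mat K V * mat_adjoint (A_mat K V)) * A_mat K V * Phi_mat N K C"

primrec precoded ::
  "nat \<Rightarrow> nat \<Rightarrow> nat \<Rightarrow> nat \<Rightarrow> (nat \<Rightarrow> complex Matrix.vec) \<Rightarrow> nat \<Rightarrow> complex Matrix.vec" where
  "precoded N K C V X 0 = X 0"
| "precoded N K C V X (Suc i) =
     (1\<^sub>m K - P_mat N K C V) *\<^sub>v X (Suc i) +
     (P_mat N K C V * mat_adjoint (Phi_mat N K C)) *\<^sub>v precoded N K C V X i"

subsection \<open>TD-NC-OFDM\<close>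

definition nth_deriv :: "nat \<Rightarrow> (real \<Rightarrow> complex) \<Rightarrow> real \<Rightarrow> complex" where
  "nth_deriv v g = ((\<lambda>h t. vector_derivative h (at t)) ^^ v) g"

definition ofdm_symbol :: "nat \<Rightarrow> nat \<Rightarrow> complex Matrix.vec \<Rightarrow> real \<Rightarrow> complex" where
  "ofdm_symbol N K x n =
     1 / of_nat N * (\<Sum>m<K. x $ m * cis (2 * pi * of_int (subcarrier K m) * n / real N))"

definition basis_fun :: "nat \<Rightarrow> nat \<Rightarrow> nat \<Rightarrow> real \<Rightarrow> complex" where
  "basis_fun N K C n =
     1 / of_nat N * (\<Sum>m<K. cis (- phi N C * of_int (subcarrier K m)) *
                            cis (2 * pi * of_int (subcarrier K m) * n / real N))"

definition Pf_mat :: "nat \<Rightarrow> nat \<Rightarrow> nat \<Rightarrow> nat \<Rightarrow> complex mat" where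
  "Pf_mat N K C V =
     Matrix.mat (V + 1) (V + 1) (\<lambda>(u, v). nth_deriv (u + v) (basis_fun N K C) (- real C))"

text \<open>In the next three definitions \<open>prev\<close> is the preceding smoothed symbol and \<open>y\<close> the current
  original symbol.\<close>

definition delta_vec ::
  "nat \<Rightarrow> nat \<Rightarrow> nat \<Rightarrow> (real \<Rightarrow> complex) \<Rightarrow> (real \<Rightarrow> complex) \<Rightarrow> complex Matrix.vec" where
  "delta_vec N C V prev y =
     Matrix.vec (V + 1) (\<lambda>v. nth_deriv v prev (real N) - nth_deriv v y (- real C))"

definition b_vec ::
  "nat \<Rightarrow> nat \<Rightarrow> nat \<Rightarrow> nat \<Rightarrow> (real \<Rightarrow> complex) \<Rightarrow> (real \<Rightarrow> complex) \<Rightarrow> complex Matrix.vec" where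
  "b_vec N K C V prev y = minv (Pf_mat N K C V) *\<^sub>v delta_vec N C V prev y"

definition smooth_signal_of ::
  "nat \<Rightarrow> nat \<Rightarrow> nat \<Rightarrow> nat \<Rightarrow> (real \<Rightarrow> complex) \<Rightarrow> (real \<Rightarrow> complex) \<Rightarrow> real \<Rightarrow> complex" where
  "smooth_signal_of N K C V prev y n =
     (\<Sum>v\<le>V. b_vec N K C V prev y $ v * nth_deriv v (basis_fun N K C) n)"

primrec smoothed ::
  "nat \<Rightarrow> nat \<Rightarrow> nat \<Rightarrow> nat \<Rightarrow> (nat \<Rightarrow> complex Matrix.vec) \<Rightarrow> nat \<Rightarrow> real \<Rightarrow> complex" where
  "smoothed N K C V X 0 = ofdm_symbol N K (X 0)"
| "smoothed N K C V X (Suc i) =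
     (\<lambda>n. ofdm_symbol N K (X (Suc i)) n +
          smooth_signal_of N K C V (smoothed N K C V X i) (ofdm_symbol N K (X (Suc i))) n)"

text \<open>Meaningful only for \<open>i \<ge> 1\<close>.\<close>

definition smooth_signal ::
  "nat \<Rightarrow> nat \<Rightarrow> nat \<Rightarrow> nat \<Rightarrow> (nat \<Rightarrow> complex Matrix.vec) \<Rightarrow> nat \<Rightarrow> real \<Rightarrow> complex" where
  "smooth_signal N K C V X i =
     smooth_signal_of N K C V (smoothed N K C V X (i - 1)) (ofdm_symbol N K (X i))"

end

theory Submission
  imports Defs
begin

text \<open>
  Let \<open>D\<close> be the diagonal matrix with entries \<open>(2\<pi>j/N)\<^sup>v\<close>, and write \<open>A\<close>, \<open>\<Phi>\<close>, \<open>P\<close> for \<open>A_mat\<close>,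
  \<open>Phi_mat\<close>, \<open>P_mat\<close>.  Differentiating a trigonometric polynomial multiplies its coefficients by
  \<open>2\<pi>jk\<^sub>m/N\<close>, and evaluating it at \<open>-N\<^sub>c\<^sub>p\<close> multiplies them by the entries of \<open>\<Phi>\<close>.  As \<open>A\<close> is real,
  this gives \<open>P\<^sub>f = D A A\<^sup>H D / N\<close>, while the jump between a preceding symbol with coefficients \<open>x'\<close>
  and a current one with coefficients \<open>x\<close> is \<open>D A (x' - \<Phi> x) / N\<close>.  The Vandermonde matrix \<open>A\<close> has
  full row rank, so \<open>b = D\<^sup>-\<^sup>1 (A A\<^sup>H)\<^sup>-\<^sup>1 A (x' - \<Phi> x)\<close>, and the smooth signal has coefficients
  \<open>\<Phi>\<^sup>H A\<^sup>H D b = P \<Phi>\<^sup>H x' - P x\<close>.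
\<close>

section \<open>Matrix inverses, adjoints and diagonal matrices\<close>

text \<open>A square matrix with trivial kernel has nonzero determinant, so
  \<open>mat_inverse\<close> returns a \<open>Some\<close> and \<open>minv\<close> is a genuine
  two-sided inverse. Invertibility is phrased through the kernel because that is how it is
  established for both the Gram matrix of \<open>A_mat\<close> and \<open>Pf_mat\<close>.\<close>

lemma minv_inverts:
  assumes M: "M \<in> carrier_mat n n"
    and inj: "\<And>v. v \<in> carrier_vec n \<Longrightarrow> M *\<^sub>v v = 0\<^sub>v n \<Longrightarrow> v = 0\<^sub>v n"
  shows "minv M \<in> carrier_mat n n" "M * minv M = 1\<^sub>m n" "minv M * M = 1\<^sub>m n"
proof -
  have "det M \<noteq> 0"
    using det_0_iff_vec_prod_zero_field[OF M] inj by blast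
  then have "M \<in> Units (ring_mat TYPE(complex) n ())"
    by (rule det_non_zero_imp_unit[OF M])
  then obtain B where "mat_inverse M = Some B"
    using mat_inverse(1)[OF M, where b = "()"] by (cases "mat_inverse M") auto
  then show "minv M \<in> carrier_mat n n" "M * minv M = 1\<^sub>m n" "minv M * M = 1\<^sub>m n"
    using mat_inverse(2)[OF M, of B] by (auto simp: minv_def)
qed

lemma mat_mult_vec_index:
  assumes "A \<in> carrier_mat nr nc" "v \<in> carrier_vec nc" "i < nr"
  shows "(A *\<^sub>v v) $ i = (\<Sum>j<nc. A $$ (i, j) * v $ j)"
  using assms by (auto simp: scalar_prod_def atLeast0LessThan intro!: sum.cong)

lemma mat_diag_mult_vec_index:
  assumes "v \<in> carrier_vec n" "i < n"
  shows "(mat_diag n f *\<^sub>v v) $ i = f i * v $ i"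
  using assms
  by (subst mat_mult_vec_index[of _ n n])
    (auto simp: mat_diag_def if_distrib[where f = "\<lambda>x. x * y" for y] cong: if_cong)

lemma mat_adjoint_carrier [simp]:
  "A \<in> carrier_mat nr nc \<Longrightarrow> mat_adjoint A \<in> carrier_mat nc nr"
  by (auto simp: mat_adjoint_def)

lemma dim_mat_adjoint [simp]:
  "dim_row (mat_adjoint A) = dim_col A" "dim_col (mat_adjoint A) = dim_row A"
  by (auto simp: mat_adjoint_def)

lemma mat_adjoint_index:
  assumes "A \<in> carrier_mat nr nc" "i < nc" "j < nr"
  shows "mat_adjoint A $$ (i, j) = conjugate (A $$ (j, i))"
  using assms by (auto simp: mat_adjoint_def mat_of_rows_def)

lemma mat_adjoint_mat_diag:
  "mat_adjoint (mat_diag n f) = mat_diag n (\<lambda>i. conjugate (f i))"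
  by (rule eq_matI)
    (auto simp: mat_adjoint_index[of _ n n] mat_diag_def)

section \<open>Shapes of the matrices and the action of the phase matrix\<close>

lemma subcarrier_eq_iff [simp]: "subcarrier K m = subcarrier K m' \<longleftrightarrow> m = m'"
  by (simp add: subcarrier_def)

lemma A_mat_carrier [simp]: "A_mat K V \<in> carrier_mat (V + 1) K"
  by (simp add: A_mat_def)

lemma dim_A_mat [simp]: "dim_row (A_mat K V) = V + 1" "dim_col (A_mat K V) = K"
  by (simp_all add: A_mat_def)

lemma Phi_mat_carrier [simp]: "Phi_mat N K C \<in> carrier_mat K K"
  by (simp add: Phi_mat_def)

lemma dim_Phi_mat [simp]: "dim_row (Phi_mat N K C) = K" "dim_col (Phi_mat N K C) = K"
  by (simp_all add: Phi_mat_def mat_diag_def)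

lemma adjoint_A_mat_index:
  "m < K \<Longrightarrow> v \<le> V \<Longrightarrow> mat_adjoint (A_mat K V) $$ (m, v) = of_int (subcarrier K m) ^ v"
  by (subst mat_adjoint_index[OF A_mat_carrier]) (auto simp: A_mat_def)

lemma Phi_mat_mult_index:
  "x \<in> carrier_vec K \<Longrightarrow> m < K \<Longrightarrow>
    (Phi_mat N K C *\<^sub>v x) $ m = cis (phi N C * of_int (subcarrier K m)) * x $ m"
  by (simp add: Phi_mat_def mat_diag_mult_vec_index del: index_mult_mat_vec)

lemma adjoint_Phi_mat_mult_index:
  "x \<in> carrier_vec K \<Longrightarrow> m < K \<Longrightarrow>
    (mat_adjoint (Phi_mat N K C) *\<^sub>v x) $ m = cis (- phi N C * of_int (subcarrier K m)) * x $ m"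
  by (simp add: Phi_mat_def mat_adjoint_mat_diag mat_diag_mult_vec_index cis_cnj
      del: index_mult_mat_vec)

text \<open>The diagonal entries lie on the unit circle, so conjugate phases multiply to 1: one half
  of the unitarity of \<open>Phi_mat\<close>.\<close>

lemma Phi_mat_adjoint_cancel:
  assumes x: "x \<in> carrier_vec K"
  shows "Phi_mat N K C *\<^sub>v (mat_adjoint (Phi_mat N K C) *\<^sub>v x) = x"
proof -
  have c: "mat_adjoint (Phi_mat N K C) *\<^sub>v x \<in> carrier_vec K"
    using x by (meson Phi_mat_carrier mat_adjoint_carrier mult_mat_vec_carrier)
  show "Phi_mat N K C *\<^sub>v (mat_adjoint (Phi_mat N K C) *\<^sub>v x) = x"
    using x c
    by (intro eq_vecI)
      (auto simp: Phi_mat_mult_index adjoint_Phi_mat_mult_index mult.assoc[symmetric] cis_mult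
        simp del: index_mult_mat_vec)
qed

section \<open>The Vandermonde matrix and its Gram matrix\<close>

lemma A_mat_mult_index:
  "x \<in> carrier_vec K \<Longrightarrow> v \<le> V \<Longrightarrow>
    (A_mat K V *\<^sub>v x) $ v = (\<Sum>m<K. of_int (subcarrier K m) ^ v * x $ m)"
  by (subst mat_mult_vec_index[of _ "V + 1" K]) (auto simp: A_mat_def intro!: sum.cong)

lemma adjoint_A_mat_mult_index:
  "c \<in> carrier_vec (V + 1) \<Longrightarrow> m < K \<Longrightarrow>
    (mat_adjoint (A_mat K V) *\<^sub>v c) $ m = (\<Sum>v\<le>V. of_int (subcarrier K m) ^ v * c $ v)"
  by (subst mat_mult_vec_index[OF mat_adjoint_carrier[OF A_mat_carrier]])
    (auto simp: adjoint_A_mat_index lessThan_Suc_atMost intro!: sum.cong)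

text \<open>A vector in the kernel is the coefficient list of a polynomial of degree at most \<open>V\<close> that
  vanishes at the \<open>K\<close> subcarriers.\<close>

lemma adjoint_A_mat_injective:
  assumes c: "c \<in> carrier_vec (V + 1)" and VK: "V + 1 \<le> K"
    and zero: "mat_adjoint (A_mat K V) *\<^sub>v c = 0\<^sub>v K"
  shows "c = 0\<^sub>v (V + 1)"
proof -
  define p where "p = (\<Sum>v\<le>V. monom (c $ v) v)"
  let ?R = "(\<lambda>m. of_int (subcarrier K m) :: complex) ` {..<K}"
  have root: "poly p (of_int (subcarrier K m)) = 0" if "m < K" for m
    using adjoint_A_mat_mult_index[OF c that] zero that
    by (simp add: p_def poly_sum poly_monom mult.commute del: index_mult_mat_vec)
  have "degree p \<le> V"
    unfolding p_def by (intro degree_sum_le) (auto intro: order.trans[OF degree_monom_le])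
  moreover have "card ?R = K"
    by (subst card_image) (auto simp: inj_on_def)
  ultimately have "p = 0"
    using root VK by (intro poly_eqI_degree[of ?R]) auto
  moreover have "coeff p v = c $ v" if "v \<le> V" for v
    using that by (simp add: p_def coeff_sum)
  ultimately show ?thesis
    using c by (intro eq_vecI) auto
qed

text \<open>With \<open>u = A^H c\<close> one has \<open>c^H (A A^H) c = |u|^2\<close>, so a kernel
  vector of the Gram matrix is already killed by \<open>A^H\<close>, which is injective.\<close>

lemma gram_A_mat_injective:
  assumes c: "c \<in> carrier_vec (V + 1)" and VK: "V + 1 \<le> K"
    and zero: "(A_mat K V * mat_adjoint (A_mat K V)) *\<^sub>v c = 0\<^sub>v (V + 1)"
  shows "c = 0\<^sub>v (V + 1)"
proof -
  let ?u = "mat_adjoint (A_mat K V) *\<^sub>v c"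
  have u: "?u \<in> carrier_vec K"
    using c by (meson A_mat_carrier mat_adjoint_carrier mult_mat_vec_carrier)
  have Au: "A_mat K V *\<^sub>v ?u = 0\<^sub>v (V + 1)"
    using zero c by (simp add: assoc_mult_mat_vec[of _ "V + 1" K _ "V + 1"] del: One_nat_def)
  \<comment> \<open>The entries of \<open>A_mat\<close> are real, so conjugation only reaches
    \<open>c\<close>.\<close>
  have cnj_u: "cnj (?u $ m) = (\<Sum>v\<le>V. of_int (subcarrier K m) ^ v * cnj (c $ v))" if "m < K" for m
    unfolding adjoint_A_mat_mult_index[OF c that] by simp
  have "(\<Sum>m<K. cnj (?u $ m) * ?u $ m)
      = (\<Sum>m<K. \<Sum>v\<le>V. cnj (c $ v) * (of_int (subcarrier K m) ^ v * ?u $ m))"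
    by (intro sum.cong refl)
      (simp add: cnj_u sum_distrib_right sum_distrib_left mult_ac del: index_mult_mat_vec)
  also have "\<dots> = (\<Sum>v\<le>V. cnj (c $ v) * (A_mat K V *\<^sub>v ?u) $ v)"
    by (subst sum.swap) (auto simp: A_mat_mult_index[OF u] sum_distrib_left
        simp del: index_mult_mat_vec intro!: sum.cong)
  also have "\<dots> = 0"
    unfolding Au by simp
  \<comment> \<open>Rewriting the sum with real summands makes it a vanishing sum of nonnegative
    terms, so each term is 0.\<close>
  finally have "(\<Sum>m<K. complex_of_real ((cmod (?u $ m))\<^sup>2)) = 0"
    by (simp only: complex_norm_square mult.commute)
  then have "(\<Sum>m<K. (cmod (?u $ m))\<^sup>2) = 0"
    unfolding of_real_sum[symmetric] of_real_eq_0_iff .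
  then have "?u $ m = 0" if "m < K" for m
    using that by (subst (asm) sum_nonneg_eq_0_iff) (auto simp del: index_mult_mat_vec)
  then have "?u = 0\<^sub>v K"
    using u by (intro eq_vecI) (auto simp del: index_mult_mat_vec)
  then show ?thesis
    by (rule adjoint_A_mat_injective[OF c VK])
qed

section \<open>Derivatives and boundary values of OFDM symbols\<close>

text \<open>OFDM symbols are closed under differentiation, so all analysis reduces to multiplying
  coefficient vectors; this is the only place where derivatives are computed.\<close>

lemma nth_deriv_ofdm_symbol:
  "nth_deriv v (ofdm_symbol N K x) =
    ofdm_symbol N K
      (Matrix.vec K (\<lambda>m. (2 * pi * \<i> * of_int (subcarrier K m) / of_nat N) ^ v * x $ m))"
proof (induction v)
  case 0
  then show ?case
    by (simp add: nth_deriv_def ofdm_symbol_def fun_eq_iff)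
next
  case (Suc v)
  let ?x = "\<lambda>v. Matrix.vec K (\<lambda>m. (2 * pi * \<i> * of_int (subcarrier K m) / of_nat N) ^ v * x $ m)"
  \<comment> \<open>The chain rule is proved for a single real factor \<open>r\<close> and then used
    with \<open>r = a / b\<close>, matching the quotient inside the exponentials of
    \<open>ofdm_symbol\<close>.\<close>
  have cis: "((\<lambda>t. cis (a * t / b)) has_vector_derivative a / b * (\<i> * cis (a * t / b))) (at t)"
    for a b t :: real
  proof -
    have "((\<lambda>t. cis (r * t)) has_vector_derivative of_real r * (\<i> * cis (r * t))) (at t)" for r
      unfolding has_vector_derivative_def
      by (auto intro!: derivative_eq_intros simp: scaleR_conv_of_real fun_eq_iff)
    from this[of "a / b"] show ?thesis
      by simp
  qed
  have "(ofdm_symbol N K (?x v) has_vector_derivative ofdm_symbol N K (?x (Suc v)) t) (at t)" for t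
  proof -
    have "(ofdm_symbol N K (?x v) has_vector_derivative
        1 / of_nat N * (\<Sum>m<K. ?x v $ m * (of_real (2 * pi * of_int (subcarrier K m) / real N) *
          (\<i> * cis (2 * pi * of_int (subcarrier K m) * t / real N))))) (at t)"
      unfolding ofdm_symbol_def
      by (intro has_vector_derivative_mult_right has_vector_derivative_sum cis)
    also have "1 / of_nat N * (\<Sum>m<K. ?x v $ m * (of_real (2 * pi * of_int (subcarrier K m) / real N) *
          (\<i> * cis (2 * pi * of_int (subcarrier K m) * t / real N)))) = ofdm_symbol N K (?x (Suc v)) t"
      unfolding ofdm_symbol_def by (rule arg_cong2[where f = "(*)", OF refl], rule sum.cong[OF refl]) simp
    finally show ?thesis .
  qed
  then have "vector_derivative (ofdm_symbol N K (?x v)) (at t) = ofdm_symbol N K (?x (Suc v)) t" for t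
    by (rule vector_derivative_at)
  moreover have "nth_deriv (Suc v) g = (\<lambda>t. vector_derivative (nth_deriv v g) (at t))" for g
    by (simp add: nth_deriv_def)
  ultimately show ?case
    by (simp only: Suc)
qed

text \<open>Seen as the symbol whose data are the conjugate phases, the basis function falls under
  the derivative formula above.\<close>

lemma basis_fun_conv_ofdm_symbol:
  "basis_fun N K C = ofdm_symbol N K (Matrix.vec K (\<lambda>m. cis (- phi N C * of_int (subcarrier K m))))"
  by (simp add: basis_fun_def ofdm_symbol_def fun_eq_iff)

lemma ofdm_symbol_prefix:
  "ofdm_symbol N K x (- real C) =
    1 / of_nat N * (\<Sum>m<K. cis (phi N C * of_int (subcarrier K m)) * x $ m)"
  by (simp add: ofdm_symbol_def phi_def mult_ac)

text \<open>At \<open>N\<close> every exponent is an integer multiple of \<open>2 * pi\<close>, so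
  all exponentials equal 1.\<close>

lemma ofdm_symbol_end:
  assumes "N > 0"
  shows "ofdm_symbol N K x (real N) = 1 / of_nat N * (\<Sum>m<K. x $ m)"
  using assms by (simp add: ofdm_symbol_def)

lemma ofdm_symbol_add:
  assumes "x \<in> carrier_vec K" "z \<in> carrier_vec K"
  shows "ofdm_symbol N K (x + z) n = ofdm_symbol N K x n + ofdm_symbol N K z n"
  using assms by (simp add: ofdm_symbol_def sum.distrib algebra_simps)

section \<open>Discrete Fourier inversion\<close>

text \<open>Orthogonality of characters: for nonzero \<open>d\<close> this is a full geometric sum
  over an \<open>N\<close>-th root of unity different from 1.\<close>

lemma sum_cis_roots:
  assumes "\<bar>d\<bar> < int N"
  shows "(\<Sum>n<N. cis (2 * pi * of_int d * real n / real N)) = (if d = 0 then of_nat N else 0)"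
proof (cases "d = 0")
  case False
  let ?z = "cis (2 * pi * of_int d / real N)"
  have N: "N > 0"
    using assms by auto
  \<comment> \<open>Ratio 1 would make \<open>N\<close> divide \<open>d\<close>, impossible for
    \<open>0 < |d| < N\<close>.\<close>
  have "?z \<noteq> 1"
  proof
    assume "?z = 1"
    then obtain l :: int where "2 * pi * of_int d / real N = of_int (2 * l) * pi"
      unfolding cis_conv_exp exp_eq_1 by auto
    then have "pi * (2 * real_of_int d) = pi * (2 * (real_of_int l * real N))"
      using N by (simp add: divide_eq_eq mult_ac)
    then have "real_of_int d = real_of_int (l * int N)"
      by simp
    then have "d = l * int N"
      by (simp only: of_int_eq_iff)
    then have "int N dvd d"
      by simp
    from dvd_imp_le_int[OF False this] show False
      using assms by simp
  qed
  moreover have "?z ^ N = 1"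
    using N by (simp add: Complex.DeMoivre)
  ultimately have "(\<Sum>n<N. ?z ^ n) = 0"
    by (subst geometric_sum) simp_all
  moreover have "?z ^ n = cis (2 * pi * of_int d * real n / real N)" for n
    unfolding Complex.DeMoivre by (rule arg_cong[where f = cis]) simp
  ultimately show ?thesis
    using False by simp
qed simp

text \<open>The synthesis already carries the factor \<open>1/N\<close>, so the unnormalised
  transform inverts it. The bound \<open>K \<le> N\<close> keeps distinct subcarriers distinct
  modulo \<open>N\<close>.\<close>

lemma F_mat_mult_ofdm_symbol:
  assumes x: "x \<in> carrier_vec K" and KN: "K \<le> N"
  shows "F_mat N K *\<^sub>v Matrix.vec N (\<lambda>n. ofdm_symbol N K x (real n)) = x"
proof (rule eq_vecI)
  fix m assume "m < dim_vec x"
  then have m: "m < K"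
    using x by simp
  then have N: "N > 0"
    using KN by simp
  have "(F_mat N K *\<^sub>v Matrix.vec N (\<lambda>n. ofdm_symbol N K x (real n))) $ m
      = (\<Sum>n<N. cis (- 2 * pi * of_int (subcarrier K m) * real n / real N) * ofdm_symbol N K x (real n))"
    using m by (subst mat_mult_vec_index[of _ K N]) (auto simp: F_mat_def intro!: sum.cong)
  also have "\<dots> = (\<Sum>n<N. \<Sum>l<K. x $ l / of_nat N *
      cis (2 * pi * of_int (subcarrier K l - subcarrier K m) * real n / real N))"
  proof (rule sum.cong[OF refl])
    fix n
    have "cis (- 2 * pi * of_int (subcarrier K m) * real n / real N) *
        cis (2 * pi * of_int (subcarrier K l) * real n / real N) =
        cis (2 * pi * of_int (subcarrier K l - subcarrier K m) * real n / real N)" for l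
      unfolding cis_mult by (rule arg_cong[where f = cis]) (simp add: diff_divide_distrib left_diff_distrib right_diff_distrib)
    then show "cis (- 2 * pi * of_int (subcarrier K m) * real n / real N) * ofdm_symbol N K x (real n)
      = (\<Sum>l<K. x $ l / of_nat N *
          cis (2 * pi * of_int (subcarrier K l - subcarrier K m) * real n / real N))"
      unfolding ofdm_symbol_def by (simp add: sum_distrib_left mult.left_commute)
  qed
  also have "\<dots> = (\<Sum>l<K. x $ l / of_nat N *
      (\<Sum>n<N. cis (2 * pi * of_int (subcarrier K l - subcarrier K m) * real n / real N)))"
    by (subst sum.swap) (simp add: sum_distrib_left)
  also have "\<dots> = (\<Sum>l<K. if l = m then x $ m else 0)"
  proof (rule sum.cong[OF refl])
    fix l assume "l \<in> {..<K}"
    \<comment> \<open>Both indices lie in a window of \<open>K\<close> consecutive integers, so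
      their difference is below \<open>K \<le> N\<close> in absolute value.\<close>
    then have "\<bar>subcarrier K l - subcarrier K m\<bar> < int N"
      using m KN by (simp add: subcarrier_def)
    then show "x $ l / of_nat N *
        (\<Sum>n<N. cis (2 * pi * of_int (subcarrier K l - subcarrier K m) * real n / real N))
        = (if l = m then x $ m else 0)"
      using N by (subst sum_cis_roots) auto
  qed
  also have "\<dots> = x $ m"
    using m by simp
  finally show "(F_mat N K *\<^sub>v Matrix.vec N (\<lambda>n. ofdm_symbol N K x (real n))) $ m = x $ m" .
qed (use x in \<open>auto simp: F_mat_def\<close>)

section \<open>The precoding matrix\<close>

lemma P_mat_carrier:
  assumes "V + 1 \<le> K"
  shows "P_mat N K C V \<in> carrier_mat K K"
proof -
  let ?S = "A_mat K V * mat_adjoint (A_mat K V)"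
  have "?S \<in> carrier_mat (V + 1) (V + 1)"
    by (meson A_mat_carrier mat_adjoint_carrier mult_carrier_mat)
  then have "minv ?S \<in> carrier_mat (V + 1) (V + 1)"
    by (rule minv_inverts(1)) (rule gram_A_mat_injective[OF _ assms])
  then show ?thesis
    unfolding P_mat_def by (meson A_mat_carrier Phi_mat_carrier mat_adjoint_carrier mult_carrier_mat)
qed

text \<open>Applying the factors one at a time exposes the inverse Gram matrix acting on
  \<open>A (Phi x)\<close>, the form in which it also appears in the coefficients
  \<open>b\<close>.\<close>

lemma P_mat_mult_vec:
  assumes "V + 1 \<le> K" and x: "x \<in> carrier_vec K"
  shows "P_mat N K C V *\<^sub>v x = mat_adjoint (Phi_mat N K C) *\<^sub>v (mat_adjoint (A_mat K V) *\<^sub>v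
    (minv (A_mat K V * mat_adjoint (A_mat K V)) *\<^sub>v (A_mat K V *\<^sub>v (Phi_mat N K C *\<^sub>v x))))"
proof -
  let ?A = "A_mat K V" and ?Phi = "Phi_mat N K C"
  let ?S = "?A * mat_adjoint ?A"
  have A: "?A \<in> carrier_mat (V + 1) K" and AH: "mat_adjoint ?A \<in> carrier_mat K (V + 1)"
    and Phi: "?Phi \<in> carrier_mat K K" and PhiH: "mat_adjoint ?Phi \<in> carrier_mat K K"
    by (meson A_mat_carrier Phi_mat_carrier mat_adjoint_carrier)+
  have "?S \<in> carrier_mat (V + 1) (V + 1)"
    using A AH by (rule mult_carrier_mat)
  then have I: "minv ?S \<in> carrier_mat (V + 1) (V + 1)"
    by (rule minv_inverts(1)) (rule gram_A_mat_injective[OF _ assms(1)])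
  note mc = mult_carrier_mat mult_mat_vec_carrier
  have v1: "?Phi *\<^sub>v x \<in> carrier_vec K"
    using Phi x by (rule mc)
  have v2: "?A *\<^sub>v (?Phi *\<^sub>v x) \<in> carrier_vec (V + 1)"
    using A v1 by (rule mc)
  have v3: "minv ?S *\<^sub>v (?A *\<^sub>v (?Phi *\<^sub>v x)) \<in> carrier_vec (V + 1)"
    using I v2 by (rule mc)
  have m1: "mat_adjoint ?Phi * mat_adjoint ?A \<in> carrier_mat K (V + 1)"
    using PhiH AH by (rule mc)
  have m2: "mat_adjoint ?Phi * mat_adjoint ?A * minv ?S \<in> carrier_mat K (V + 1)"
    using m1 I by (rule mc)
  have m3: "mat_adjoint ?Phi * mat_adjoint ?A * minv ?S * ?A \<in> carrier_mat K K"
    using m2 A by (rule mc)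
  show ?thesis
    unfolding P_mat_def assoc_mult_mat_vec[OF m3 Phi x] assoc_mult_mat_vec[OF m2 A v1]
      assoc_mult_mat_vec[OF m1 I v2] assoc_mult_mat_vec[OF PhiH AH v3] ..
qed

section \<open>The matrix of basis derivatives\<close>

text \<open>The conjugate phases in the basis function cancel those produced by evaluation at
  \<open>-C\<close>. What remains is a power sum of the subcarriers, which is a Gram entry because
  \<open>A_mat\<close> is real.\<close>

lemma Pf_mat_index:
  assumes "u \<le> V" "v \<le> V"
  shows "Pf_mat N K C V $$ (u, v) =
    1 / of_nat N * (2 * pi * \<i> / of_nat N) ^ (u + v) *
      (A_mat K V * mat_adjoint (A_mat K V)) $$ (u, v)"
proof -
  have "Pf_mat N K C V $$ (u, v) = 1 / of_nat N *
      (\<Sum>m<K. (2 * pi * \<i> * of_int (subcarrier K m) / of_nat N) ^ (u + v))"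
    using assms
    by (auto simp: Pf_mat_def basis_fun_conv_ofdm_symbol nth_deriv_ofdm_symbol ofdm_symbol_prefix
        mult.left_commute[of "cis _"] cis_mult intro!: sum.cong)
  also have "\<dots> = 1 / of_nat N * (2 * pi * \<i> / of_nat N) ^ (u + v) *
      (\<Sum>m<K. of_int (subcarrier K m) ^ u * of_int (subcarrier K m) ^ v)"
    unfolding mult.assoc sum_distrib_left
    by (intro sum.cong refl) (simp add: power_add power_mult_distrib power_divide mult_ac)
  also have "(\<Sum>m<K. of_int (subcarrier K m) ^ u * of_int (subcarrier K m) ^ v)
      = (A_mat K V * mat_adjoint (A_mat K V)) $$ (u, v)"
  proof -
    show ?thesis
      using assms
      by (simp add: scalar_prod_def adjoint_A_mat_index atLeast0LessThan) (simp add: A_mat_def)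
  qed
  finally show ?thesis .
qed

text \<open>This is \<open>P_f = D A A^H D / N\<close> applied to a vector; the diagonal
  \<open>D\<close> is kept as entrywise scaling instead of a matrix.\<close>

lemma Pf_mat_mult_index:
  assumes x: "x \<in> carrier_vec (V + 1)" and u: "u \<le> V"
  shows "(Pf_mat N K C V *\<^sub>v x) $ u =
    1 / of_nat N * (2 * pi * \<i> / of_nat N) ^ u *
      ((A_mat K V * mat_adjoint (A_mat K V)) *\<^sub>v
        Matrix.vec (V + 1) (\<lambda>v. (2 * pi * \<i> / of_nat N) ^ v * x $ v)) $ u"
proof -
  have S: "A_mat K V * mat_adjoint (A_mat K V) \<in> carrier_mat (V + 1) (V + 1)"
    by (meson A_mat_carrier mat_adjoint_carrier mult_carrier_mat)
  have Pf: "Pf_mat N K C V \<in> carrier_mat (V + 1) (V + 1)"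
    by (simp add: Pf_mat_def)
  have "(Pf_mat N K C V *\<^sub>v x) $ u = (\<Sum>v<V + 1. Pf_mat N K C V $$ (u, v) * x $ v)"
    using u by (intro mat_mult_vec_index[OF Pf x]) simp
  also have "\<dots> = (\<Sum>v<V + 1. 1 / of_nat N * (2 * pi * \<i> / of_nat N) ^ u *
      ((A_mat K V * mat_adjoint (A_mat K V)) $$ (u, v) *
        ((2 * pi * \<i> / of_nat N) ^ v * x $ v)))"
  proof (rule sum.cong[OF refl])
    fix v assume "v \<in> {..<V + 1}"
    then have "v \<le> V"
      by simp
    show "Pf_mat N K C V $$ (u, v) * x $ v = 1 / of_nat N * (2 * pi * \<i> / of_nat N) ^ u *
      ((A_mat K V * mat_adjoint (A_mat K V)) $$ (u, v) *
        ((2 * pi * \<i> / of_nat N) ^ v * x $ v))"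
      unfolding Pf_mat_index[OF u \<open>v \<le> V\<close>] power_add by (simp only: mult_ac)
  qed
  also have "\<dots> = 1 / of_nat N * (2 * pi * \<i> / of_nat N) ^ u *
      ((A_mat K V * mat_adjoint (A_mat K V)) *\<^sub>v
        Matrix.vec (V + 1) (\<lambda>v. (2 * pi * \<i> / of_nat N) ^ v * x $ v)) $ u"
    unfolding sum_distrib_left[symmetric]
    by (subst mat_mult_vec_index[OF S]) (use u in auto)
  finally show ?thesis .
qed

text \<open>Since \<open>2 * pi * \<i> / N\<close> is nonzero, both scalings by its powers can be
  undone, and the Gram matrix between them is injective.\<close>

lemma Pf_mat_injective:
  assumes x: "x \<in> carrier_vec (V + 1)" and VK: "V + 1 \<le> K" and N: "N > 0"
    and zero: "Pf_mat N K C V *\<^sub>v x = 0\<^sub>v (V + 1)"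
  shows "x = 0\<^sub>v (V + 1)"
proof -
  let ?S = "A_mat K V * mat_adjoint (A_mat K V)"
  let ?d = "Matrix.vec (V + 1) (\<lambda>v. (2 * pi * \<i> / of_nat N) ^ v * x $ v)"
  have S: "?S \<in> carrier_mat (V + 1) (V + 1)"
    by (meson A_mat_carrier mat_adjoint_carrier mult_carrier_mat)
  have Sd: "(?S *\<^sub>v ?d) $ u = 0" if "u \<le> V" for u
  proof -
    have "1 / of_nat N * (2 * pi * \<i> / of_nat N) ^ u * (?S *\<^sub>v ?d) $ u = 0"
      unfolding Pf_mat_mult_index[OF x that, of N K C, symmetric] zero using that by simp
    moreover have "1 / of_nat N * (2 * pi * \<i> / of_nat N) ^ u \<noteq> (0 :: complex)"
      using N by simp
    ultimately show ?thesis
      using mult_eq_0_iff by blast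
  qed
  have "?S *\<^sub>v ?d = 0\<^sub>v (V + 1)"
    by (rule eq_vecI) (use S Sd in \<open>auto simp del: index_mult_mat_vec simp: less_Suc_eq_le\<close>)
  then have d: "?d = 0\<^sub>v (V + 1)"
    by (rule gram_A_mat_injective[OF vec_carrier VK])
  have "x $ v = 0" if "v \<le> V" for v
  proof -
    have "?d $ v = 0"
      unfolding d using that by simp
    then show ?thesis
      using that N by simp
  qed
  then show ?thesis
    using x by (intro eq_vecI) auto
qed

section \<open>Jump vector, coefficients and smooth signal\<close>

text \<open>The exponentials are 1 at the end of the preceding symbol and the entries of
  \<open>Phi_mat\<close> at the start of the current prefix, which gives \<open>x' - Phi x\<close>.
  Order \<open>v\<close> contributes the common factor \<open>(2 * pi * \<i> / N)^v\<close>.\<close>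

lemma delta_vec_ofdm_symbol_index:
  assumes x: "x \<in> carrier_vec K" and x': "x' \<in> carrier_vec K" and N: "N > 0" and v: "v \<le> V"
  shows "delta_vec N C V (ofdm_symbol N K x') (ofdm_symbol N K x) $ v =
    1 / of_nat N * (2 * pi * \<i> / of_nat N) ^ v *
      (A_mat K V *\<^sub>v (x' - Phi_mat N K C *\<^sub>v x)) $ v"
proof -
  have c: "Phi_mat N K C *\<^sub>v x \<in> carrier_vec K"
    using x by (meson Phi_mat_carrier mult_mat_vec_carrier)
  then have c': "x' - Phi_mat N K C *\<^sub>v x \<in> carrier_vec K"
    by (rule minus_carrier_vec[OF x'])
  have "delta_vec N C V (ofdm_symbol N K x') (ofdm_symbol N K x) $ v =
     1 / of_nat N * (\<Sum>m<K. (2 * pi * \<i> * of_int (subcarrier K m) / of_nat N) ^ v * x' $ m) -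
     1 / of_nat N * (\<Sum>m<K. (2 * pi * \<i> * of_int (subcarrier K m) / of_nat N) ^ v *
        (Phi_mat N K C *\<^sub>v x) $ m)"
  proof -
    have "nth_deriv v (ofdm_symbol N K x') (real N) =
        1 / of_nat N * (\<Sum>m<K. (2 * pi * \<i> * of_int (subcarrier K m) / of_nat N) ^ v * x' $ m)"
      unfolding nth_deriv_ofdm_symbol ofdm_symbol_end[OF N] by simp
    moreover have "nth_deriv v (ofdm_symbol N K x) (- real C) =
        1 / of_nat N * (\<Sum>m<K. (2 * pi * \<i> * of_int (subcarrier K m) / of_nat N) ^ v *
          (Phi_mat N K C *\<^sub>v x) $ m)"
      unfolding nth_deriv_ofdm_symbol ofdm_symbol_prefix
      by (rule arg_cong2[where f = "(*)", OF refl], rule sum.cong[OF refl])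
        (simp add: Phi_mat_mult_index[OF x] del: index_mult_mat_vec)
    ultimately show ?thesis
      using v by (simp add: delta_vec_def)
  qed
  also have "\<dots> = 1 / of_nat N * (\<Sum>m<K. (2 * pi * \<i> * of_int (subcarrier K m) / of_nat N) ^ v *
        (x' - Phi_mat N K C *\<^sub>v x) $ m)"
    unfolding right_diff_distrib[symmetric] sum_subtractf[symmetric]
    by (rule arg_cong2[where f = "(*)", OF refl], rule sum.cong[OF refl])
      (use c in \<open>simp del: index_mult_mat_vec\<close>)
  also have "\<dots> = 1 / of_nat N * (2 * pi * \<i> / of_nat N) ^ v *
      (\<Sum>m<K. of_int (subcarrier K m) ^ v * (x' - Phi_mat N K C *\<^sub>v x) $ m)"
    unfolding mult.assoc sum_distrib_left
    by (intro sum.cong refl)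
      (simp add: power_mult_distrib power_divide mult_ac del: index_mult_mat_vec index_minus_vec)
  finally show ?thesis
    unfolding A_mat_mult_index[OF c' v] .
qed

text \<open>The stated vector is checked to solve \<open>P_f b = Delta y\<close>; invertibility of
  \<open>P_f\<close> then identifies it with \<open>b_vec\<close>.\<close>

lemma b_vec_ofdm_symbol:
  assumes x: "x \<in> carrier_vec K" and x': "x' \<in> carrier_vec K" and N: "N > 0" and VK: "V + 1 \<le> K"
  shows "b_vec N K C V (ofdm_symbol N K x') (ofdm_symbol N K x) =
    Matrix.vec (V + 1) (\<lambda>v. (minv (A_mat K V * mat_adjoint (A_mat K V)) *\<^sub>v
      (A_mat K V *\<^sub>v (x' - Phi_mat N K C *\<^sub>v x))) $ v / (2 * pi * \<i> / of_nat N) ^ v)"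
proof -
  let ?S = "A_mat K V * mat_adjoint (A_mat K V)"
  let ?g = "A_mat K V *\<^sub>v (x' - Phi_mat N K C *\<^sub>v x)"
  let ?Pf = "Pf_mat N K C V"
  let ?delta = "delta_vec N C V (ofdm_symbol N K x') (ofdm_symbol N K x)"
  have S: "?S \<in> carrier_mat (V + 1) (V + 1)"
    by (meson A_mat_carrier mat_adjoint_carrier mult_carrier_mat)
  have Sinv: "minv ?S \<in> carrier_mat (V + 1) (V + 1)" "?S * minv ?S = 1\<^sub>m (V + 1)"
    by (rule minv_inverts[OF S], erule (1) gram_A_mat_injective[OF _ VK])+
  have Pf: "?Pf \<in> carrier_mat (V + 1) (V + 1)"
    by (simp add: Pf_mat_def)
  have Pfinv: "minv ?Pf \<in> carrier_mat (V + 1) (V + 1)" "minv ?Pf * ?Pf = 1\<^sub>m (V + 1)"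
    by (rule minv_inverts[OF Pf], erule (1) Pf_mat_injective[OF _ VK N])+
  have "Phi_mat N K C *\<^sub>v x \<in> carrier_vec K"
    by (rule mult_mat_vec_carrier[OF Phi_mat_carrier x])
  with x' have "x' - Phi_mat N K C *\<^sub>v x \<in> carrier_vec K"
    by (rule minus_carrier_vec)
  then have g: "?g \<in> carrier_vec (V + 1)"
    by (rule mult_mat_vec_carrier[OF A_mat_carrier])
  define c where "c = minv ?S *\<^sub>v ?g"
  \<comment> \<open>The system reads \<open>D S (D b) / N = D g / N\<close>. Cancelling the outer
    \<open>D / N\<close> leaves \<open>S (D b) = g\<close>, so \<open>D b = c\<close>.\<close>
  define b where "b = Matrix.vec (V + 1) (\<lambda>v. c $ v / (2 * pi * \<i> / of_nat N) ^ v)"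
  have c: "c \<in> carrier_vec (V + 1)"
    unfolding c_def using Sinv(1) g by (rule mult_mat_vec_carrier)
  have b: "b \<in> carrier_vec (V + 1)"
    by (simp add: b_def)
  have "Matrix.vec (V + 1) (\<lambda>v. (2 * pi * \<i> / of_nat N) ^ v * b $ v) = c"
    using c N by (intro eq_vecI) (auto simp: b_def)
  moreover have "?S *\<^sub>v c = ?g"
    unfolding c_def assoc_mult_mat_vec[OF S Sinv(1) g, symmetric] Sinv(2)
    by (rule one_mult_mat_vec[OF g])
  ultimately have "(?Pf *\<^sub>v b) $ u = ?delta $ u" if "u \<le> V" for u
    unfolding Pf_mat_mult_index[OF b that] delta_vec_ofdm_symbol_index[OF x x' N that]
    by (simp only:)
  then have "?Pf *\<^sub>v b = ?delta"
    by (intro eq_vecI) (simp_all add: delta_vec_def Pf_mat_def less_Suc_eq_le del: index_mult_mat_vec)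
  then have "b_vec N K C V (ofdm_symbol N K x') (ofdm_symbol N K x) = minv ?Pf *\<^sub>v (?Pf *\<^sub>v b)"
    by (simp only: b_vec_def)
  also have "\<dots> = b"
    unfolding assoc_mult_mat_vec[OF Pfinv(1) Pf b, symmetric] Pfinv(2)
    by (rule one_mult_mat_vec[OF b])
  finally show ?thesis
    unfolding b_def c_def .
qed

text \<open>The core of the equivalence: the smooth signal is itself an OFDM symbol, with the
  precoding correction as its data. Both sides reduce to the coefficients \<open>Phi^H A^H c\<close>
  with \<open>c = (A A^H)^-1 A (x' - Phi x)\<close>.\<close>

lemma smooth_signal_of_ofdm_symbol:
  assumes x: "x \<in> carrier_vec K" and x': "x' \<in> carrier_vec K" and N: "N > 0" and VK: "V + 1 \<le> K"
  shows "smooth_signal_of N K C V (ofdm_symbol N K x') (ofdm_symbol N K x) =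
    ofdm_symbol N K ((- P_mat N K C V) *\<^sub>v x + (P_mat N K C V * mat_adjoint (Phi_mat N K C)) *\<^sub>v x')"
proof
  fix n
  let ?A = "A_mat K V" and ?Phi = "Phi_mat N K C" and ?P = "P_mat N K C V"
  let ?S = "?A * mat_adjoint ?A"
  let ?c = "minv ?S *\<^sub>v (?A *\<^sub>v (x' - ?Phi *\<^sub>v x))"
  let ?y = "mat_adjoint ?Phi *\<^sub>v x'"
  note mc = mult_mat_vec_carrier
  have A: "?A \<in> carrier_mat (V + 1) K" and AH: "mat_adjoint ?A \<in> carrier_mat K (V + 1)"
    and Phi: "?Phi \<in> carrier_mat K K" and PhiH: "mat_adjoint ?Phi \<in> carrier_mat K K"
    by (meson A_mat_carrier Phi_mat_carrier mat_adjoint_carrier)+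
  have P: "?P \<in> carrier_mat K K"
    by (rule P_mat_carrier[OF VK])
  have "?S \<in> carrier_mat (V + 1) (V + 1)"
    using A AH by (rule mult_carrier_mat)
  then have I: "minv ?S \<in> carrier_mat (V + 1) (V + 1)"
    by (rule minv_inverts(1)) (rule gram_A_mat_injective[OF _ VK])
  have y: "?y \<in> carrier_vec K" and Px: "?P *\<^sub>v x \<in> carrier_vec K" and Phix: "?Phi *\<^sub>v x \<in> carrier_vec K"
    using mc[OF PhiH x'] mc[OF P x] mc[OF Phi x] by this+
  have Py: "?P *\<^sub>v ?y \<in> carrier_vec K"
    using P y by (rule mc)
  have yx: "?y - x \<in> carrier_vec K"
    using y x by (rule minus_carrier_vec)
  have c: "?c \<in> carrier_vec (V + 1)"
    by (rule mc[OF I mc[OF A minus_carrier_vec[OF x' Phix]]])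
  have e: "mat_adjoint ?A *\<^sub>v ?c \<in> carrier_vec K"
    using AH c by (rule mc)
  have "(- ?P) *\<^sub>v x + (?P * mat_adjoint ?Phi) *\<^sub>v x' = ?P *\<^sub>v ?y - ?P *\<^sub>v x"
    unfolding assoc_mult_mat_vec[OF P PhiH x']
    using P x Px Py by (intro eq_vecI) auto
  also have "\<dots> = ?P *\<^sub>v (?y - x)"
    by (rule mult_minus_distrib_mat_vec[OF P y x, symmetric])
  \<comment> \<open>Unitarity gives \<open>Phi (Phi^H x' - x) = x' - Phi x\<close>, the vector
    entering \<open>b\<close>.\<close>
  also have "\<dots> = mat_adjoint ?Phi *\<^sub>v (mat_adjoint ?A *\<^sub>v ?c)"
    unfolding P_mat_mult_vec[OF VK yx] mult_minus_distrib_mat_vec[OF Phi y x]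
      Phi_mat_adjoint_cancel[OF x'] ..
  finally have coeffs: "(- ?P) *\<^sub>v x + (?P * mat_adjoint ?Phi) *\<^sub>v x' =
    mat_adjoint ?Phi *\<^sub>v (mat_adjoint ?A *\<^sub>v ?c)" .
  \<comment> \<open>The division in \<open>b\<close> cancels the constant part of the factor from
    the \<open>v\<close>-th derivative, leaving the Vandermonde entry.\<close>
  have cancel: "?c $ v / (2 * pi * \<i> / of_nat N) ^ v *
      ((2 * pi * \<i> * of_int (subcarrier K m) / of_nat N) ^ v * z) =
      z * (of_int (subcarrier K m) ^ v * ?c $ v)" for v m and z :: complex
  proof -
    have "(2 * pi * \<i> * of_int (subcarrier K m) / of_nat N) ^ v =
        (2 * pi * \<i> / of_nat N) ^ v * (of_int (subcarrier K m) :: complex) ^ v"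
      by (simp add: power_mult_distrib power_divide)
    moreover have "(2 * pi * \<i> / of_nat N) ^ v \<noteq> (0 :: complex)"
      using N by simp
    moreover have "a / d * (d * k * z) = z * (k * a)" if "d \<noteq> 0" for a d k :: complex
      using that by simp
    ultimately show ?thesis
      by (simp only:)
  qed
  have "smooth_signal_of N K C V (ofdm_symbol N K x') (ofdm_symbol N K x) n =
      (\<Sum>v\<le>V. ?c $ v / (2 * pi * \<i> / of_nat N) ^ v * nth_deriv v (basis_fun N K C) n)"
    unfolding smooth_signal_of_def b_vec_ofdm_symbol[OF x x' N VK]
    by (intro sum.cong refl) (simp del: index_mult_mat_vec)
  also have "\<dots> = (\<Sum>v\<le>V. \<Sum>m<K. 1 / of_nat N *
      (cis (- phi N C * of_int (subcarrier K m)) * (of_int (subcarrier K m) ^ v * ?c $ v) *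
        cis (2 * pi * of_int (subcarrier K m) * n / real N)))"
  proof (rule sum.cong[OF refl])
    fix v
    have "?c $ v / (2 * pi * \<i> / of_nat N) ^ v * nth_deriv v (basis_fun N K C) n =
      (\<Sum>m<K. 1 / of_nat N * ((?c $ v / (2 * pi * \<i> / of_nat N) ^ v *
        ((2 * pi * \<i> * of_int (subcarrier K m) / of_nat N) ^ v *
          cis (- phi N C * of_int (subcarrier K m)))) *
        cis (2 * pi * of_int (subcarrier K m) * n / real N)))"
      unfolding basis_fun_conv_ofdm_symbol nth_deriv_ofdm_symbol ofdm_symbol_def sum_distrib_left
      by (intro sum.cong refl) (simp add: mult_ac del: index_mult_mat_vec)
    then show "?c $ v / (2 * pi * \<i> / of_nat N) ^ v * nth_deriv v (basis_fun N K C) n =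
      (\<Sum>m<K. 1 / of_nat N *
        (cis (- phi N C * of_int (subcarrier K m)) * (of_int (subcarrier K m) ^ v * ?c $ v) *
          cis (2 * pi * of_int (subcarrier K m) * n / real N)))"
      unfolding cancel .
  qed
  \<comment> \<open>Summing over \<open>v\<close> first for each fixed \<open>m\<close> assembles
    the entry of \<open>A^H c\<close> at that subcarrier.\<close>
  also have "\<dots> = ofdm_symbol N K (mat_adjoint ?Phi *\<^sub>v (mat_adjoint ?A *\<^sub>v ?c)) n"
    unfolding ofdm_symbol_def sum_distrib_left
    by (subst sum.swap)
      (auto simp: adjoint_Phi_mat_mult_index[OF e] adjoint_A_mat_mult_index[OF c]
        sum_distrib_left sum_distrib_right simp del: index_mult_mat_vec intro!: sum.cong)
  finally show "smooth_signal_of N K C V (ofdm_symbol N K x') (ofdm_symbol N K x) n =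
      ofdm_symbol N K ((- ?P) *\<^sub>v x + (?P * mat_adjoint ?Phi) *\<^sub>v x') n"
    unfolding coeffs .
qed

section \<open>The two recursions in parallel\<close>

lemma precoding_correction_carrier:
  assumes "V + 1 \<le> K" "x \<in> carrier_vec K" "x' \<in> carrier_vec K"
  shows "(- P_mat N K C V) *\<^sub>v x + (P_mat N K C V * mat_adjoint (Phi_mat N K C)) *\<^sub>v x'
    \<in> carrier_vec K"
proof (rule add_carrier_vec)
  note P = P_mat_carrier[OF assms(1)]
  show "(- P_mat N K C V) *\<^sub>v x \<in> carrier_vec K"
    by (rule mult_mat_vec_carrier[OF uminus_carrier_mat[OF P] assms(2)])
  show "(P_mat N K C V * mat_adjoint (Phi_mat N K C)) *\<^sub>v x' \<in> carrier_vec K"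
    by (rule mult_mat_vec_carrier[OF mult_carrier_mat[OF P mat_adjoint_carrier[OF Phi_mat_carrier]] assms(3)])
qed

text \<open>Splitting off the raw data gives the precoding recursion the shape of
  \<open>smoothed\<close>: current symbol plus correction.\<close>

lemma precoded_Suc_eq_add_correction:
  assumes VK: "V + 1 \<le> K" and X: "X (Suc i) \<in> carrier_vec K"
    and prev: "precoded N K C V X i \<in> carrier_vec K"
  shows "precoded N K C V X (Suc i) = X (Suc i) + ((- P_mat N K C V) *\<^sub>v X (Suc i) +
    (P_mat N K C V * mat_adjoint (Phi_mat N K C)) *\<^sub>v precoded N K C V X i)"
proof -
  let ?P = "P_mat N K C V"
  have P: "?P \<in> carrier_mat K K"
    by (rule P_mat_carrier[OF VK])
  have PX: "?P *\<^sub>v X (Suc i) \<in> carrier_vec K"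
    using P X by (rule mult_mat_vec_carrier)
  have "(?P * mat_adjoint (Phi_mat N K C)) *\<^sub>v precoded N K C V X i \<in> carrier_vec K"
    by (rule mult_mat_vec_carrier[OF mult_carrier_mat[OF P mat_adjoint_carrier[OF Phi_mat_carrier]] prev])
  moreover have "(1\<^sub>m K - ?P) *\<^sub>v X (Suc i) = X (Suc i) - ?P *\<^sub>v X (Suc i)"
    using minus_mult_distrib_mat_vec[OF one_carrier_mat P X] X by simp
  moreover have "(- ?P) *\<^sub>v X (Suc i) = - (?P *\<^sub>v X (Suc i))"
    using P X by simp
  ultimately show ?thesis
    using X PX by (intro eq_vecI) (auto simp del: index_mult_mat_vec)
qed

lemma precoded_carrier:
  assumes "V + 1 \<le> K" and "\<And>i. X i \<in> carrier_vec K"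
  shows "precoded N K C V X i \<in> carrier_vec K"
proof (induction i)
  case (Suc i)
  show ?case
    unfolding precoded_Suc_eq_add_correction[OF assms(1,2) Suc]
    by (rule add_carrier_vec[OF assms(2) precoding_correction_carrier[OF assms(1,2) Suc]])
qed (simp add: assms(2))

text \<open>By induction the preceding smoothed signal is an OFDM symbol with precoded data, so the
  smooth signal formula applies; linearity then adds the correction to the data. The equality is one
  of functions on the reals.\<close>

lemma smoothed_eq_ofdm_symbol_precoded:
  assumes VK: "V + 1 \<le> K" and N: "N > 0" and X: "\<And>i. X i \<in> carrier_vec K"
  shows "smoothed N K C V X i = ofdm_symbol N K (precoded N K C V X i)"
proof (induction i)
  case (Suc i)
  note prev = precoded_carrier[where X = X, OF VK X, of N C i]
  show ?case
    unfolding smoothed.simps Suc smooth_signal_of_ofdm_symbol[OF X prev N VK]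
      precoded_Suc_eq_add_correction[OF VK X prev]
    by (intro ext ofdm_symbol_add[symmetric] X precoding_correction_carrier[OF VK X prev])
qed simp

theorem mainTheorem1:
  fixes N K Ncp V :: nat and X :: "nat \<Rightarrow> complex Matrix.vec"
  assumes "K \<ge> 2" and "even K" and "K \<le> N" and "V + 1 \<le> K"
    and "\<And>i. X i \<in> carrier_vec K"
  shows "(\<forall>i\<ge>1.
            F_mat N K *\<^sub>v Matrix.vec N (\<lambda>n. smooth_signal N K Ncp V X i (real n)) =
              (- P_mat N K Ncp V) *\<^sub>v X i +
              (P_mat N K Ncp V * mat_adjoint (Phi_mat N K Ncp)) *\<^sub>v precoded N K Ncp V X (i - 1)) \<and>
         (\<forall>i. \<forall>n\<in>{- int Ncp..int N - 1}.
            smoothed N K Ncp V X i (real_of_int n) =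
              1 / of_nat N *
                (\<Sum>m<K. precoded N K Ncp V X i $ m *
                        cis (2 * pi * of_int (subcarrier K m) * of_int n / real N)))"
proof -
  have N: "N > 0"
    using assms(1,3) by simp
  note X = assms(5) and VK = assms(4)
  note smoothed = smoothed_eq_ofdm_symbol_precoded[where X = X, OF VK N X]
  have "F_mat N K *\<^sub>v Matrix.vec N (\<lambda>n. smooth_signal N K Ncp V X i (real n)) =
      (- P_mat N K Ncp V) *\<^sub>v X i +
      (P_mat N K Ncp V * mat_adjoint (Phi_mat N K Ncp)) *\<^sub>v precoded N K Ncp V X (i - 1)" for i
  proof -
    note prev = precoded_carrier[where X = X, OF VK X, of N Ncp "i - 1"]
    \<comment> \<open>Once the smooth signal is written as the symbol of the correction vector,
      Fourier inversion on its samples returns that vector.\<close>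
    show ?thesis
      unfolding smooth_signal_def smoothed smooth_signal_of_ofdm_symbol[OF X prev N VK]
      by (rule F_mat_mult_ofdm_symbol[OF precoding_correction_carrier[OF VK X prev] assms(3)])
  qed
  then show ?thesis
    unfolding smoothed ofdm_symbol_def by simp
qed

end
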